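(* Let $\mathbf{B}(x,\lambda)$ be a real symmetric $4\times 4$ matrix depending smoothly on $(x,\lambda)\in\mathbb{R}^2$ and let $\mathbf{A}(x,\lambda)=\mathbf{J}^{-1}\mathbf{B}(x,\lambda)$. Fix $\lambda$ and let $\mathbf{Z}(x)\in\mathbb{R}^{4\times 2}$ be a path of Lagrangian frames satisfying $\mathbf{Z}_x=\mathbf{A}(x,\lambda)\mathbf{Z}$. Let $V\subset\mathbb{R}^4$ be a fixed Lagrangian plane. Suppose that at $x=x_0$ the plane spanned by the columns of $\mathbf{Z}(x_0)$ intersects $V$ in a one-dimensional subspace $\mathrm{span}\{\xi\}$, where $\xi=\mathbf{Z}(x_0)\beta$ with $\beta\in\mathbb{R}^2\setminus\{0\}$. Then the crossing form $$\Gamma(\mathbf{Z},V,x_0)=\langle\mathbf{J}\mathbf{Z}'(x_0)\beta,\mathbf{Z}(x_0)\beta\rangle\,\mathrm{vol}$$ satisfies $$\Gamma(\mathbf{Z},V,x_0)=\langle\mathbf{B}(x_0,\lambda)\xi,\xi\rangle\,\mathrm{vol}=\boldsymbol{\omega}\wedge\xi\wedge\mathbf{A}(x_0,\lambda)\xi .$$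
   Context: $\mathbf{J}=\begin{pmatrix}\mathbf{0}&-\mathbf{I}\\ \mathbf{I}&\mathbf{0}\end{pmatrix}$ is the standard symplectic operator on $\mathbb{R}^4$ ($2\times 2$ blocks), $\langle\cdot,\cdot\rangle$ is the standard inner product on $\mathbb{R}^4$, $\mathbf{e}_1,\dots,\mathbf{e}_4$ is the canonical basis, $\mathrm{vol}=\mathbf{e}_1\wedge\mathbf{e}_2\wedge\mathbf{e}_3\wedge\mathbf{e}_4$ and $\boldsymbol{\omega}=\mathbf{e}_1\wedge\mathbf{e}_3+\mathbf{e}_2\wedge\mathbf{e}_4$. A Lagrangian plane is a two-dimensional subspace $\mathrm{span}\{\mathbf{z}_1,\mathbf{z}_2\}$ of $\mathbb{R}^4$ with $\langle\mathbf{J}\mathbf{z}_1,\mathbf{z}_2\rangle=0$. A Lagrangian frame is a real $4\times2$ matrix of rank 2 whose columns span a Lagrangian plane. $\mathbf{Z}'(x_0)$ denotes the derivative of $\mathbf{Z}$ with respect to $x$ at $x_0$. *)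

theory Defs
  imports "HOL-Analysis.Analysis"
begin

text \<open>
  The exterior algebra of real^'n, in its concrete model with basis the blades
  axis S 1 for S a subset of the index type: the blade of {i1 < ... < ik} is the product
  e_i1 \<and> ... \<and> e_ik. The choice of the linear order on the index type only fixes the signs
  relating this basis to ordered products of vectors; the algebra does not depend on it.
  (For the type 4 the order is 0 < 1 < 2 < 3 and 4 = 0, so e_4 comes first in a blade.)
\<close>

type_synonym 'n multivector = "real ^ 'n set"

definition blade_sign :: "'n::{finite,linorder} set \<Rightarrow> 'n set \<Rightarrow> real" where
  "blade_sign S T =
     (if S \<inter> T = {} then (-1) ^ card {(i, j). i \<in> S \<and> j \<in> T \<and> j < i} else 0)"

definition wedge ::
    "'n::{finite,linorder} multivector \<Rightarrow> 'n multivector \<Rightarrow> 'n multivector"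
    (infixl "\<^bold>\<and>" 70) where
  "x \<^bold>\<and> y = (\<Sum>S\<in>UNIV. \<Sum>T\<in>UNIV. (x $ S * y $ T * blade_sign S T) *\<^sub>R axis (S \<union> T) 1)"

definition of_vec :: "real ^ ('n::{finite,linorder}) \<Rightarrow> 'n multivector" where
  "of_vec v = (\<Sum>i\<in>UNIV. v $ i *\<^sub>R axis {i} 1)"

lemma linear_wedge:
  fixes v :: "'n::{finite,linorder} multivector"
  shows "linear (\<lambda>u. u \<^bold>\<and> v)" "linear (\<lambda>u. v \<^bold>\<and> u)"
proof -
  show "linear (\<lambda>u. u \<^bold>\<and> v)"
    by (rule linearI; simp only: wedge_def vector_add_component vector_scaleR_component
        real_scaleR_def distrib_right scaleR_add_left sum.distrib scaleR_sum_right
        scaleR_scaleR mult.assoc)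
  show "linear (\<lambda>u. v \<^bold>\<and> u)"
    by (rule linearI; simp only: wedge_def vector_add_component vector_scaleR_component
        real_scaleR_def distrib_right distrib_left scaleR_add_left sum.distrib scaleR_sum_right
        scaleR_scaleR mult.assoc mult.left_commute)
qed

lemma linear_of_vec: "linear of_vec"
  by (rule linearI; simp only: of_vec_def vector_add_component vector_scaleR_component
      real_scaleR_def scaleR_add_left sum.distrib scaleR_sum_right scaleR_scaleR)

lemma of_vec_axis: "of_vec (axis i 1) = axis {i} 1"
proof -
  have "of_vec (axis i 1) = (\<Sum>j\<in>UNIV. if j = i then axis {j} 1 else 0 :: real ^ 'a set)"
    unfolding of_vec_def by (rule sum.cong) (auto simp: axis_def)
  then show ?thesis by simp
qed

lemma wedge_blade:
  "axis S 1 \<^bold>\<and> axis T 1 = blade_sign S T *\<^sub>R (axis (S \<union> T) 1 :: 'n::{finite,linorder} multivector)"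
proof -
  have "axis S 1 \<^bold>\<and> axis T 1 = (\<Sum>S'\<in>UNIV. \<Sum>T'\<in>UNIV. if T' = T then if S' = S then
          blade_sign S T *\<^sub>R axis (S \<union> T) 1 else 0 else (0 :: 'n multivector))"
    unfolding wedge_def by (intro sum.cong refl) (auto simp: axis_def)
  then show ?thesis by simp
qed

lemma blade_sign_Un_left:
  assumes "S \<inter> T = {}"
  shows "blade_sign (S \<union> T) R = blade_sign S R * blade_sign T R"
proof (cases "(S \<union> T) \<inter> R = {}")
  case True
  have eq: "{(i, j). i \<in> S \<union> T \<and> j \<in> R \<and> j < i} =
      {(i, j). i \<in> S \<and> j \<in> R \<and> j < i} \<union> {(i, j). i \<in> T \<and> j \<in> R \<and> j < i}"
    by auto
  have "card {(i, j). i \<in> S \<union> T \<and> j \<in> R \<and> j < i} =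
      card {(i, j). i \<in> S \<and> j \<in> R \<and> j < i} + card {(i, j). i \<in> T \<and> j \<in> R \<and> j < i}"
    unfolding eq by (rule card_Un_disjoint) (use assms in auto)
  moreover have "S \<inter> R = {}" "T \<inter> R = {}" using True by auto
  ultimately show ?thesis using True by (simp only: blade_sign_def power_add simp_thms if_True)
next
  case False
  then have "S \<inter> R \<noteq> {} \<or> T \<inter> R \<noteq> {}" by auto
  with False show ?thesis by (auto simp: blade_sign_def)
qed

lemma blade_sign_Un_right:
  assumes "T \<inter> R = {}"
  shows "blade_sign S (T \<union> R) = blade_sign S T * blade_sign S R"
proof (cases "S \<inter> (T \<union> R) = {}")
  case True
  have eq: "{(i, j). i \<in> S \<and> j \<in> T \<union> R \<and> j < i} =
      {(i, j). i \<in> S \<and> j \<in> T \<and> j < i} \<union> {(i, j). i \<in> S \<and> j \<in> R \<and> j < i}"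
    by auto
  have "card {(i, j). i \<in> S \<and> j \<in> T \<union> R \<and> j < i} =
      card {(i, j). i \<in> S \<and> j \<in> T \<and> j < i} + card {(i, j). i \<in> S \<and> j \<in> R \<and> j < i}"
    unfolding eq by (rule card_Un_disjoint) (use assms in auto)
  moreover have "S \<inter> T = {}" "S \<inter> R = {}" using True by auto
  ultimately show ?thesis using True by (simp only: blade_sign_def power_add simp_thms if_True)
next
  case False
  then have "S \<inter> T \<noteq> {} \<or> S \<inter> R \<noteq> {}" by auto
  with False show ?thesis by (auto simp: blade_sign_def)
qed

lemma blade_sign_cocycle:
  "blade_sign S T * blade_sign (S \<union> T) R = blade_sign T R * blade_sign S (T \<union> R)"
proof (cases "S \<inter> T = {} \<and> T \<inter> R = {}")
  case True
  then show ?thesis by (simp add: blade_sign_Un_left blade_sign_Un_right)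
next
  case False
  have "blade_sign S T = 0 \<or> blade_sign (S \<union> T) R = 0"
    using False by (auto simp: blade_sign_def)
  moreover have "blade_sign T R = 0 \<or> blade_sign S (T \<union> R) = 0"
    using False by (auto simp: blade_sign_def)
  ultimately show ?thesis by auto
qed

lemma linear_eq_on_blades:
  fixes f g :: "real ^ 'm \<Rightarrow> 'b::real_vector"
  assumes "linear f" "linear g" "\<And>S. f (axis S 1) = g (axis S 1)"
  shows "f x = g x"
proof -
  have "f b = g b" if "b \<in> Basis" for b
    using that assms(3) by (auto simp: Basis_vec_def)
  then have "f = g" by (rule linear_eq_stdbasis[OF assms(1,2)])
  then show ?thesis by simp
qed

lemma wedge_assoc: "(x \<^bold>\<and> y) \<^bold>\<and> z = x \<^bold>\<and> (y \<^bold>\<and> z)"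
proof -
  have blades: "(axis S 1 \<^bold>\<and> axis T 1) \<^bold>\<and> axis R 1 =
      axis S 1 \<^bold>\<and> (axis T 1 \<^bold>\<and> axis R 1 :: 'a multivector)" for S T R
    by (simp only: wedge_blade linear_scale[OF linear_wedge(1)] linear_scale[OF linear_wedge(2)]
        scaleR_scaleR blade_sign_cocycle Un_assoc)
  have lin: "linear (\<lambda>w. f (g w))" if "linear f" "linear g"
    for f g :: "'a multivector \<Rightarrow> 'a multivector"
    using linear_compose[OF that(2,1)] by (simp add: o_def)
  have 1: "(axis S 1 \<^bold>\<and> axis T 1) \<^bold>\<and> w = axis S 1 \<^bold>\<and> (axis T 1 \<^bold>\<and> w)"
    for S T and w :: "'a multivector"
    by (rule linear_eq_on_blades[OF linear_wedge(2) lin[OF linear_wedge(2) linear_wedge(2)] blades])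
  have 2: "(axis S 1 \<^bold>\<and> v) \<^bold>\<and> w = axis S 1 \<^bold>\<and> (v \<^bold>\<and> w)"
    for S and v w :: "'a multivector"
    by (rule linear_eq_on_blades[OF lin[OF linear_wedge(1) linear_wedge(2)]
          lin[OF linear_wedge(2) linear_wedge(1)] 1])
  show ?thesis
    by (rule linear_eq_on_blades[OF lin[OF linear_wedge(1) linear_wedge(1)] linear_wedge(1) 2])
qed

lemma wedge_of_vec_axis_commute:
  "of_vec (axis i 1) \<^bold>\<and> of_vec (axis j 1) = - (of_vec (axis j 1) \<^bold>\<and> of_vec (axis i 1))"
proof -
  have "{(k, l). k \<in> {a} \<and> l \<in> {b} \<and> l < k} = (if b < a then {(a, b)} else {})" for a b :: 'a
    by auto
  then have "blade_sign {a} {b} = (if a = b then 0 else if b < a then - 1 else 1)" for a b :: 'a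
    by (simp only: blade_sign_def) auto
  then show ?thesis
    by (cases i j rule: linorder_cases) (auto simp: of_vec_axis wedge_blade insert_commute)
qed

lemma wedge_of_vec_expand:
  "of_vec u \<^bold>\<and> of_vec v =
     (\<Sum>i\<in>UNIV. \<Sum>j\<in>UNIV. (u $ i * v $ j) *\<^sub>R (of_vec (axis i 1) \<^bold>\<and> of_vec (axis j 1)))"
proof -
  have "of_vec w = (\<Sum>i\<in>UNIV. w $ i *\<^sub>R of_vec (axis i 1))" for w :: "real ^ ('a::{finite,linorder})"
    unfolding of_vec_axis by (rule of_vec_def)
  from this[of u] this[of v] show ?thesis
    by (simp only: linear_sum[OF linear_wedge(1)] linear_scale[OF linear_wedge(1)] linear_sum[OF linear_wedge(2)]
        linear_scale[OF linear_wedge(2)] scaleR_sum_right scaleR_scaleR)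
      (subst sum.swap, simp only: mult.commute)
qed

lemma wedge_of_vec_commute: "of_vec u \<^bold>\<and> of_vec v = - (of_vec v \<^bold>\<and> of_vec u)"
proof -
  have "of_vec u \<^bold>\<and> of_vec v =
      (\<Sum>i\<in>UNIV. \<Sum>j\<in>UNIV. - ((v $ j * u $ i) *\<^sub>R (of_vec (axis j 1) \<^bold>\<and> of_vec (axis i 1))))"
    unfolding wedge_of_vec_expand[of u v]
    by (intro sum.cong refl, subst wedge_of_vec_axis_commute)
      (simp only: scaleR_minus_right mult.commute)
  also have "\<dots> = - (of_vec v \<^bold>\<and> of_vec u)"
    unfolding wedge_of_vec_expand[of v u] sum_negf by (subst sum.swap) (rule refl)
  finally show ?thesis .
qed

lemma wedge_of_vec_self: "of_vec v \<^bold>\<and> of_vec v = 0"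
proof -
  have "2 *\<^sub>R (of_vec v \<^bold>\<and> of_vec v) = 0"
    using wedge_of_vec_commute[of v v] by (metis add.right_inverse scaleR_2)
  then show ?thesis by simp
qed

definition basis_vec :: "4 \<Rightarrow> 4 multivector" where
  "basis_vec i = of_vec (axis i 1)"

definition vol :: "4 multivector" where
  "vol = basis_vec 1 \<^bold>\<and> basis_vec 2 \<^bold>\<and> basis_vec 3 \<^bold>\<and> basis_vec 4"

definition symp_omega :: "4 multivector" where
  "symp_omega = basis_vec 1 \<^bold>\<and> basis_vec 3 + basis_vec 2 \<^bold>\<and> basis_vec 4"

lemma vol_nonzero: "vol \<noteq> 0"
proof -
  have neq: "blade_sign S T \<noteq> 0" if "S \<inter> T = {}" for S T :: "4 set"
    using that by (simp add: blade_sign_def)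
  have "vol = (blade_sign {1} {2 :: 4} * blade_sign {1, 2} {3 :: 4} * blade_sign {1, 2, 3} {4 :: 4}) *\<^sub>R
      axis {1, 2, 3, 4 :: 4} 1"
    by (simp add: vol_def basis_vec_def of_vec_axis wedge_blade linear_scale[OF linear_wedge(1)] insert_commute)
  moreover have "blade_sign {1} {2 :: 4} \<noteq> 0" "blade_sign {1, 2} {3 :: 4} \<noteq> 0"
    "blade_sign {1, 2, 3} {4 :: 4} \<noteq> 0"
    by (auto intro!: neq)
  ultimately show ?thesis by (metis axis_eq_0_iff mult_eq_0_iff one_neq_zero scaleR_eq_0_iff)
qed

definition symp_J :: "real ^ 4 ^ 4" where
  "symp_J = vector [vector [0, 0, -1,  0],
                    vector [0, 0,  0, -1],
                    vector [1, 0,  0,  0],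
                    vector [0, 1,  0,  0]]"

definition lagrangian_plane :: "(real ^ 4) set \<Rightarrow> bool" where
  "lagrangian_plane V \<longleftrightarrow>
     dim V = 2 \<and> (\<exists>z1 z2. V = span {z1, z2} \<and> inner (symp_J *v z1) z2 = 0)"

definition lagrangian_frame :: "real ^ 2 ^ 4 \<Rightarrow> bool" where
  "lagrangian_frame Z \<longleftrightarrow> rank Z = 2 \<and> lagrangian_plane (span (columns Z))"

primrec times_cont_diff :: "nat \<Rightarrow> ('a::real_normed_vector \<Rightarrow> 'b::real_normed_vector) \<Rightarrow> bool" where
  "times_cont_diff 0 f \<longleftrightarrow> continuous_on UNIV f"
| "times_cont_diff (Suc k) f \<longleftrightarrow>
     (\<forall>p. f differentiable (at p)) \<and>
     (\<forall>v. times_cont_diff k (\<lambda>p. frechet_derivative f (at p) v))"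

text \<open>
  On a finite-dimensional domain this is C-infinity: times_cont_diff k asks for continuity of
  the iterated directional derivatives, which for finite dimension is the C-k property.
\<close>

definition smooth :: "('a::euclidean_space \<Rightarrow> 'b::real_normed_vector) \<Rightarrow> bool" where
  "smooth f \<longleftrightarrow> (\<forall>k. times_cont_diff k f)"

text \<open>
  The crossing form of the path Z, defined on the interval I, evaluated at the intersection
  vector Z x0 *v \<beta>. The reference plane V enters only through the choice of \<beta>, which is
  subject to Z x0 *v \<beta> \<in> V. The derivative is one-sided if x0 is an endpoint of I.
\<close>

definition crossing_form ::
    "real set \<Rightarrow> (real \<Rightarrow> real ^ 2 ^ 4) \<Rightarrow> real \<Rightarrow> real ^ 2 \<Rightarrow> 4 multivector" where
  "crossing_form I Z x0 \<beta> =
     inner (symp_J *v (vector_derivative Z (at x0 within I) *v \<beta>)) (Z x0 *v \<beta>) *\<^sub>R vol"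

end

theory Submission
  imports Defs
begin

text \<open>
  The first equality is the differential equation read at one point: since
  \<open>A = J\<^sup>-\<^sup>1 B\<close>, the vector \<open>Z' \<beta>\<close> equals \<open>A \<xi>\<close> and \<open>J A \<xi> = B \<xi>\<close>.

  The second one rests on the identity \<open>\<omega> \<and> u \<and> v = \<langle>u, J v\<rangle> vol\<close>
  (\<open>symp_omega_wedge_of_vec\<close>), applied to \<open>u = \<xi>\<close> and
  \<open>v = A \<xi>\<close>, for which \<open>J v = B \<xi>\<close> again. Both sides of that identity are bilinear in
  \<open>u\<close> and \<open>v\<close>, so it is enough to compare them on the sixteen pairs of basis vectors. There
  anticommutativity sorts every product of four basis vectors into \<open>vol\<close> up to sign, or
  makes it vanish because of a repeated factor.
\<close>

lemma vector_4:
  "(vector [a, b, c, d] :: 'a::zero ^ 4) $ 1 = a"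
  "(vector [a, b, c, d] :: 'a ^ 4) $ 2 = b"
  "(vector [a, b, c, d] :: 'a ^ 4) $ 3 = c"
  "(vector [a, b, c, d] :: 'a ^ 4) $ 4 = d"
  unfolding vector_def by simp_all

lemma symp_J_mult_vec:
  "symp_J *v v = vector [- v $ 3, - v $ 4, v $ 1, v $ 2]"
  by (simp add: vec_eq_iff forall_4 matrix_vector_mult_def sum_4 symp_J_def vector_4)

lemma symp_J_mult_matrix_inv: "symp_J ** matrix_inv symp_J = mat 1"
proof -
  have "symp_J ** - symp_J = mat 1"
    by (simp add: vec_eq_iff forall_4 matrix_matrix_mult_def sum_4 symp_J_def vector_4 mat_def)
  then have "invertible symp_J"
    unfolding invertible_right_inverse by blast
  then show ?thesis
    unfolding matrix_inv_def invertible_def by (rule someI_ex[THEN conjunct1])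
qed

lemma basis_vec_anticommute: "basis_vec i \<^bold>\<and> basis_vec j = - (basis_vec j \<^bold>\<and> basis_vec i)"
  unfolding basis_vec_def by (rule wedge_of_vec_commute)

lemma basis_vec_left_anticommute:
  "basis_vec i \<^bold>\<and> (basis_vec j \<^bold>\<and> x) = - (basis_vec j \<^bold>\<and> (basis_vec i \<^bold>\<and> x))"
  by (metis basis_vec_anticommute linear_neg[OF linear_wedge(1)] wedge_assoc)

lemma basis_vec_self: "basis_vec i \<^bold>\<and> basis_vec i = 0"
  unfolding basis_vec_def by (rule wedge_of_vec_self)

lemma basis_vec_left_self: "basis_vec i \<^bold>\<and> (basis_vec i \<^bold>\<and> x) = 0"
  by (metis basis_vec_self linear_0[OF linear_wedge(1)] wedge_assoc)

text \<open>
  The wedge with \<open>e\<^sub>1 \<and> e\<^sub>3\<close> sees only the term \<open>e\<^sub>2 \<and> e\<^sub>4\<close> of \<open>\<omega>\<close>, and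
  \<open>e\<^sub>2 \<and> e\<^sub>4 \<and> e\<^sub>1 \<and> e\<^sub>3 = - vol\<close> because the permutation is odd; likewise for
  \<open>e\<^sub>2 \<and> e\<^sub>4\<close>. This sign is what puts \<open>J\<close> on the second argument:
  \<open>- \<langle>J u, v\<rangle> = \<langle>u, J v\<rangle>\<close>.
\<close>

lemma symp_omega_wedge_basis_vec:
  "symp_omega \<^bold>\<and> (basis_vec i \<^bold>\<and> basis_vec j) = (symp_J *v axis j 1) $ i *\<^sub>R vol"
proof -
  \<comment> \<open>Restricted to pairs in decreasing order, anticommutation terminates as a rewrite rule.\<close>
  note sort =
    basis_vec_anticommute[of 2 1] basis_vec_anticommute[of 3 1] basis_vec_anticommute[of 4 1]
    basis_vec_anticommute[of 3 2] basis_vec_anticommute[of 4 2] basis_vec_anticommute[of 4 3]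
    basis_vec_left_anticommute[of 2 1] basis_vec_left_anticommute[of 3 1]
    basis_vec_left_anticommute[of 4 1] basis_vec_left_anticommute[of 3 2]
    basis_vec_left_anticommute[of 4 2] basis_vec_left_anticommute[of 4 3]
  show ?thesis
    using exhaust_4[of i] exhaust_4[of j]
    by (elim disjE)
      (simp_all add: symp_omega_def vol_def wedge_assoc sort basis_vec_self basis_vec_left_self
        linear_add[OF linear_wedge(1)] linear_neg[OF linear_wedge(2)] linear_0[OF linear_wedge(2)]
        symp_J_mult_vec vector_4 axis_def)
qed

lemma symp_omega_wedge_of_vec:
  "symp_omega \<^bold>\<and> (of_vec u \<^bold>\<and> of_vec v) = inner u (symp_J *v v) *\<^sub>R vol"
proof -
  have "symp_omega \<^bold>\<and> (of_vec u \<^bold>\<and> of_vec v) =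
      (\<Sum>i\<in>UNIV. \<Sum>j\<in>UNIV. (u $ i * v $ j) *\<^sub>R ((symp_J *v axis j 1) $ i *\<^sub>R vol))"
    by (simp only: wedge_of_vec_expand[of u v] linear_sum[OF linear_wedge(2)]
        linear_scale[OF linear_wedge(2)] symp_omega_wedge_basis_vec flip: basis_vec_def)
  also have "\<dots> = (\<Sum>i\<in>UNIV. \<Sum>j\<in>UNIV. u $ i * v $ j * (symp_J *v axis j 1) $ i) *\<^sub>R vol"
    by (simp add: scaleR_sum_left)
  also have "(\<Sum>i\<in>UNIV. \<Sum>j\<in>UNIV. u $ i * v $ j * (symp_J *v axis j 1) $ i) =
      inner u (symp_J *v v)"
    by (simp add: sum_4 inner_vec_def symp_J_mult_vec vector_4 axis_def)
  finally show ?thesis .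
qed

theorem mainTheorem1:
  fixes A B :: "real \<Rightarrow> real \<Rightarrow> real ^ 4 ^ 4"
    and Z :: "real \<Rightarrow> real ^ 2 ^ 4"
    and V :: "(real ^ 4) set"
    and I :: "real set"
    and l x0 :: real
    and \<xi> :: "real ^ 4"
    and \<beta> :: "real ^ 2"
  assumes B_smooth: "smooth (\<lambda>(x, y). B x y)"
    and B_symmetric: "\<And>x y. transpose (B x y) = B x y"
    and A_eq: "\<And>x y. A x y = matrix_inv symp_J ** B x y"
    and I_interval: "is_interval I" "x0 \<in> I" "I \<noteq> {x0}"
    and Z_frame: "\<And>x. x \<in> I \<Longrightarrow> lagrangian_frame (Z x)"
    and Z_ode: "\<And>x. x \<in> I \<Longrightarrow> (Z has_vector_derivative A x l ** Z x) (at x within I)"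
    and V_lagrangian: "lagrangian_plane V"
    and crossing: "span (columns (Z x0)) \<inter> V = span {\<xi>}" "dim (span {\<xi>}) = 1"
    and \<xi>_eq: "\<xi> = Z x0 *v \<beta>"
    and \<beta>_nonzero: "\<beta> \<noteq> 0"
  shows "crossing_form I Z x0 \<beta> = inner (B x0 l *v \<xi>) \<xi> *\<^sub>R vol \<and>
         inner (B x0 l *v \<xi>) \<xi> *\<^sub>R vol = symp_omega \<^bold>\<and> of_vec \<xi> \<^bold>\<and> of_vec (A x0 l *v \<xi>)"
proof -
  have J_A: "symp_J *v (A x0 l *v \<xi>) = B x0 l *v \<xi>"
    by (simp add: A_eq matrix_vector_mul_assoc matrix_mul_assoc symp_J_mult_matrix_inv)

  \<comment> \<open>A one-sided derivative at an endpoint is determined because \<open>I\<close> does not reduce to a point.\<close>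
  have "x0 islimpt I"
    using I_interval by (intro connected_imp_perfect is_interval_connected) auto
  then have "vector_derivative Z (at x0 within I) = A x0 l ** Z x0"
    using Z_ode[OF \<open>x0 \<in> I\<close>] by (simp add: vector_derivative_within trivial_limit_within)
  then have "crossing_form I Z x0 \<beta> = inner (B x0 l *v \<xi>) \<xi> *\<^sub>R vol"
    using J_A by (simp add: crossing_form_def \<xi>_eq matrix_vector_mul_assoc)
  moreover have "inner (B x0 l *v \<xi>) \<xi> *\<^sub>R vol = symp_omega \<^bold>\<and> of_vec \<xi> \<^bold>\<and> of_vec (A x0 l *v \<xi>)"
    by (simp add: wedge_assoc symp_omega_wedge_of_vec J_A inner_commute)
  ultimately show ?thesis ..
qed

end
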